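(* Let $\mathsf{EQ}:\{0,1\}^n\times\{0,1\}^n\to\{0,1\}$ be the equality function $\mathsf{EQ}(x,y)=\mathbf{1}[x=y]$. Then $\bar{\mathrm{R}}_\varepsilon(\mathsf{EQ})\le\tilde{O}(1/\varepsilon^{2/3})$ (with the hidden factor independent of $n$).
   Context: Distributed estimation of $f$: Alice holds a probability distribution $p$ on $\{0,1\}^n$, Bob a probability distribution $q$ on $\{0,1\}^n$, and they must output an estimate within additive error $\varepsilon$ of $\mathbb{E}_{x\sim p,y\sim q}[f(x,y)]$ (for $\mathsf{EQ}$ this is $\sum_x p(x)q(x)$). $\bar{\mathrm{R}}_\varepsilon(f)$ is the minimum worst-case communication of a shared-randomness randomized protocol that succeeds with probability at least $2/3$ on every input pair. $\tilde{O}$ hides polylogarithmic factors in $1/\varepsilon$ only. *)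

theory Defs
  imports "HOL-Probability.Probability"
begin

text \<open>Deterministic two-party protocol trees. At an inner node the owner of the node sends one bit
  computed from its own input; the bit \<open>False\<close> leads to the first subtree and \<open>True\<close> to the second.
  A leaf carries the common output, so the output is a function of the transcript alone.\<close>

datatype ('a, 'b, 'o) protocol =
    Output 'o
  | Alice "'a \<Rightarrow> bool" "('a, 'b, 'o) protocol" "('a, 'b, 'o) protocol"
  | Bob "'b \<Rightarrow> bool" "('a, 'b, 'o) protocol" "('a, 'b, 'o) protocol"

primrec run :: "('a, 'b, 'o) protocol \<Rightarrow> 'a \<Rightarrow> 'b \<Rightarrow> 'o" where
  "run (Output v) a b = v"
| "run (Alice s l r) a b = (if s a then run r a b else run l a b)"
| "run (Bob s l r) a b = (if s b then run r a b else run l a b)"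

primrec depth :: "('a, 'b, 'o) protocol \<Rightarrow> nat" where
  "depth (Output v) = 0"
| "depth (Alice s l r) = Suc (max (depth l) (depth r))"
| "depth (Bob s l r) = Suc (max (depth l) (depth r))"

definition bitstrings :: "nat \<Rightarrow> bool list set" where
  "bitstrings n = {x. length x = n}"

definition dists :: "nat \<Rightarrow> bool list pmf set" where
  "dists n = {p. set_pmf p \<subseteq> bitstrings n}"

text \<open>A protocol with shared randomness is a probability distribution over deterministic protocols.
  The inputs of the players are the distributions themselves, not samples from them.\<close>

type_synonym rand_est_protocol = "(bool list pmf, bool list pmf, real) protocol pmf"

definition estimates ::
  "nat \<Rightarrow> real \<Rightarrow> (bool list \<Rightarrow> bool list \<Rightarrow> real) \<Rightarrow> rand_est_protocol \<Rightarrow> bool" where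
  "estimates n \<epsilon> f P \<longleftrightarrow> (\<forall>p\<in>dists n. \<forall>q\<in>dists n.
     measure_pmf.prob P
       {t. \<bar>run t p q - measure_pmf.expectation (pair_pmf p q) (\<lambda>(x, y). f x y)\<bar> \<le> \<epsilon>} \<ge> 2 / 3)"

definition worst_case_cost :: "('a, 'b, 'o) protocol pmf \<Rightarrow> enat" where
  "worst_case_cost P = (SUP t\<in>set_pmf P. enat (depth t))"

text \<open>The infimum is taken in \<^typ>\<open>enat\<close>: it is attained whenever some protocol estimates \<open>f\<close>, and it
  is \<open>\<infinity>\<close> if there is none.\<close>

definition Rbar :: "nat \<Rightarrow> real \<Rightarrow> (bool list \<Rightarrow> bool list \<Rightarrow> real) \<Rightarrow> enat" where
  "Rbar n \<epsilon> f = (INF P\<in>{P. estimates n \<epsilon> f P}. worst_case_cost P)"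

definition EQ_fun :: "bool list \<Rightarrow> bool list \<Rightarrow> real" where
  "EQ_fun x y = of_bool (x = y)"

end

theory Submission
  imports Defs
begin

text \<open>Split each distribution at the threshold \<open>\<tau> = \<epsilon> powr (2 / 3)\<close>. At most \<open>1 / \<tau>\<close> points are
  heavy, so the heavy parts can be sent explicitly, rounded and with the points hashed into
  \<open>O(1 / \<epsilon>)\<close> buckets; the expected weight of hash collisions is at most the inverse of the number
  of buckets, whatever \<open>n\<close> is. The squared \<open>L2\<close> norm of a light part is at most \<open>\<tau>\<close>, so
  the inner product of the two light parts is estimated by a CountSketch with \<open>t\<close> entries up to a
  mean square error of \<open>2 * \<tau>\<^sup>2 / t\<close>, which is \<open>O(\<epsilon>\<^sup>2)\<close> for \<open>t\<close> of order \<open>1 / \<tau>\<close>. The second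
  moment bound follows by adding one coordinate at a time: the new random bucket and sign are
  independent of the sketch built so far, and the cross term vanishes.\<close>

section \<open>Sending messages from finite sets\<close>

text \<open>Each bit tells whether the message lies in a chosen subset \<open>T\<close>, with at
  most \<open>2 ^ k\<close> messages on either side, so the bits single out the message and the
  continuation \<open>c (msg a)\<close> is grafted at the end of its path.\<close>

lemma send_Alice:
  assumes "finite S" "card S \<le> 2 ^ k" "\<And>m. m \<in> S \<Longrightarrow> depth (c m) \<le> d"
  shows "\<exists>t. depth t \<le> k + d \<and> (\<forall>a b. msg a \<in> S \<longrightarrow> run t a b = run (c (msg a)) a b)"
  using assms
proof (induction k arbitrary: S)
  case 0
  show ?case
  proof (cases "S = {}")
    case True
    \<comment> \<open>No message is admissible, so the claim about \<open>run\<close> is vacuous and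
      any leaf serves.\<close>
    then show ?thesis
      by (intro exI[of _ "Output undefined"]) simp
  next
    case False
    then have "0 < card S"
      using 0 by (simp add: card_gt_0_iff)
    then have "card S = 1"
      using 0 by simp
    then obtain m where "S = {m}"
      by (rule card_1_singletonE)
    then show ?thesis
      using 0 by (intro exI[of _ "c m"]) auto
  qed
next
  case (Suc k)
  obtain T where T: "T \<subseteq> S" "card T = min (card S) (2 ^ k)"
    using obtain_subset_with_card_n[of "min (card S) (2 ^ k)" S] by (metis min.cobounded1)
  have fin: "finite T" "finite (S - T)"
    using finite_subset[OF T(1)] Suc.prems(1) by simp_all
  have "card (S - T) = card S - min (card S) (2 ^ k)"
    using card_Diff_subset[OF fin(1) T(1)] T(2) by simp
  then have "card (S - T) \<le> 2 ^ k"
    using Suc.prems(2) by (simp add: min_def) linarith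
  then have "\<exists>t. depth t \<le> k + d \<and> (\<forall>a b. msg a \<in> S - T \<longrightarrow> run t a b = run (c (msg a)) a b)"
    using fin Suc.prems(3) by (intro Suc.IH) auto
  then obtain r where r: "depth r \<le> k + d"
    "\<And>a b. msg a \<in> S - T \<Longrightarrow> run r a b = run (c (msg a)) a b"
    by blast
  have "\<exists>t. depth t \<le> k + d \<and> (\<forall>a b. msg a \<in> T \<longrightarrow> run t a b = run (c (msg a)) a b)"
    using fin T Suc.prems(3) by (intro Suc.IH) auto
  then obtain l where l: "depth l \<le> k + d"
    "\<And>a b. msg a \<in> T \<Longrightarrow> run l a b = run (c (msg a)) a b"
    by blast
  show ?case
    using r l by (intro exI[of _ "Alice (\<lambda>a. msg a \<notin> T) l r"]) auto
qed

text \<open>Exchanging the players transfers the result on Alice's messages to Bob's.\<close>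

primrec swap_roles :: "('a, 'b, 'o) protocol \<Rightarrow> ('b, 'a, 'o) protocol" where
  "swap_roles (Output v) = Output v"
| "swap_roles (Alice s l r) = Bob s (swap_roles l) (swap_roles r)"
| "swap_roles (Bob s l r) = Alice s (swap_roles l) (swap_roles r)"

lemma depth_swap_roles [simp]: "depth (swap_roles t) = depth t"
  by (induction t) auto

lemma run_swap_roles [simp]: "run (swap_roles t) a b = run t b a"
  by (induction t) auto

lemma send_Bob:
  assumes "finite S" "card S \<le> 2 ^ k" "\<And>m. m \<in> S \<Longrightarrow> depth (c m) \<le> d"
  shows "\<exists>t. depth t \<le> k + d \<and> (\<forall>a b. msg b \<in> S \<longrightarrow> run t a b = run (c (msg b)) a b)"
proof -
  obtain t where t: "depth t \<le> k + d"
    "\<And>b a. msg b \<in> S \<Longrightarrow> run t b a = run (swap_roles (c (msg b))) b a"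
    using send_Alice[of S k "\<lambda>m. swap_roles (c m)" d msg] assms by auto
  then show ?thesis
    by (intro exI[of _ "swap_roles t"]) auto
qed

text \<open>The tree is assembled from the last round backwards: for all earlier messages a subtree
  is chosen, and each round is grafted below the previous one. Membership in \<open>S1\<close>,
  \<open>S2\<close>, \<open>S3\<close> is asked only of the messages really sent, so ranges can be
  checked later for each input pair.\<close>

lemma three_round_protocol:
  fixes m1 :: "'a \<Rightarrow> 'm1" and m2 :: "'m1 \<Rightarrow> 'b \<Rightarrow> 'm2" and m3 :: "'m1 \<Rightarrow> 'm2 \<Rightarrow> 'a \<Rightarrow> 'm3"
    and out :: "'m1 \<Rightarrow> 'm2 \<Rightarrow> 'm3 \<Rightarrow> 'o"
  assumes "finite S1" "card S1 \<le> 2 ^ k1" "finite S2" "card S2 \<le> 2 ^ k2"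
    "finite S3" "card S3 \<le> 2 ^ k3"
  shows "\<exists>t. depth t \<le> k1 + k2 + k3 \<and>
    (\<forall>a b. m1 a \<in> S1 \<longrightarrow> m2 (m1 a) b \<in> S2 \<longrightarrow> m3 (m1 a) (m2 (m1 a) b) a \<in> S3 \<longrightarrow>
      run t a b = out (m1 a) (m2 (m1 a) b) (m3 (m1 a) (m2 (m1 a) b) a))"
proof -
  have "\<forall>x y. \<exists>t :: ('a, 'b, 'o) protocol. depth t \<le> k3 \<and>
      (\<forall>a b. m3 x y a \<in> S3 \<longrightarrow> run t a b = out x y (m3 x y a))"
    using send_Alice[of S3 k3 "\<lambda>z. Output (out _ _ z)" 0] assms by auto
  then obtain t3 :: "'m1 \<Rightarrow> 'm2 \<Rightarrow> ('a, 'b, 'o) protocol" where t3: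
    "\<And>x y. depth (t3 x y) \<le> k3"
    "\<And>x y a b. m3 x y a \<in> S3 \<Longrightarrow> run (t3 x y) a b = out x y (m3 x y a)"
    by metis
  have "\<forall>x. \<exists>t. depth t \<le> k2 + k3 \<and>
      (\<forall>a b. m2 x b \<in> S2 \<longrightarrow> run t a b = run (t3 x (m2 x b)) a b)"
    using send_Bob[of S2 k2 "\<lambda>y. t3 _ y" k3] assms t3(1) by auto
  then obtain t2 where t2:
    "\<And>x. depth (t2 x) \<le> k2 + k3"
    "\<And>x a b. m2 x b \<in> S2 \<Longrightarrow> run (t2 x) a b = run (t3 x (m2 x b)) a b"
    by metis
  obtain t where "depth t \<le> k1 + (k2 + k3)"
    "\<And>a b. m1 a \<in> S1 \<Longrightarrow> run t a b = run (t2 (m1 a)) a b"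
    using send_Alice[of S1 k1 t2 "k2 + k3" m1] assms t2(1) by auto
  then show ?thesis
    using t2(2) t3(2) by (intro exI[of _ t]) auto
qed

section \<open>Rounding and sparse functions\<close>

definition round_down :: "real \<Rightarrow> real \<Rightarrow> real" where
  "round_down \<delta> r = \<delta> * of_int \<lfloor>r / \<delta>\<rfloor>"

text \<open>The index range is symmetric because rounding goes down: the least possible index is
  \<open>\<lfloor>- B / \<delta>\<rfloor> = - \<lceil>B / \<delta>\<rceil>\<close>.\<close>

definition grid :: "real \<Rightarrow> real \<Rightarrow> real set" where
  "grid \<delta> B = (\<lambda>k. \<delta> * of_int k) ` {- \<lceil>B / \<delta>\<rceil>..\<lceil>B / \<delta>\<rceil>}"

lemma round_down_error: "0 < \<delta> \<Longrightarrow> \<bar>round_down \<delta> r - r\<bar> \<le> \<delta>"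
proof -
  assume "0 < \<delta>"
  have "\<bar>of_int \<lfloor>r / \<delta>\<rfloor> - r / \<delta>\<bar> \<le> 1"
    by linarith
  then have "\<delta> * \<bar>of_int \<lfloor>r / \<delta>\<rfloor> - r / \<delta>\<bar> \<le> \<delta> * 1"
    using \<open>0 < \<delta>\<close> by (intro mult_left_mono) auto
  moreover have "round_down \<delta> r - r = \<delta> * (of_int \<lfloor>r / \<delta>\<rfloor> - r / \<delta>)"
    using \<open>0 < \<delta>\<close> by (simp add: round_down_def algebra_simps)
  ultimately show ?thesis
    using \<open>0 < \<delta>\<close> by (simp add: abs_mult)
qed

text \<open>Empty buckets stay empty after rounding, so sparsity survives it.\<close>

lemma round_down_0 [simp]: "round_down \<delta> 0 = 0"
  by (simp add: round_down_def)

lemma round_down_in_grid: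
  assumes "0 < \<delta>" "\<bar>r\<bar> \<le> B"
  shows "round_down \<delta> r \<in> grid \<delta> B"
proof -
  have "r / \<delta> \<le> B / \<delta>" "- (B / \<delta>) \<le> r / \<delta>"
    using assms by (auto simp: field_simps abs_le_iff)
  then have "\<lfloor>r / \<delta>\<rfloor> \<in> {- \<lceil>B / \<delta>\<rceil>..\<lceil>B / \<delta>\<rceil>}"
    by (simp, linarith)
  then show ?thesis
    by (auto simp: grid_def round_down_def)
qed

lemma finite_grid [simp]: "finite (grid \<delta> B)"
  by (simp add: grid_def)

lemma card_grid:
  assumes "0 < \<delta>" "0 \<le> B"
  shows "real (card (grid \<delta> B)) \<le> 2 * B / \<delta> + 3"
proof -
  have "card (grid \<delta> B) \<le> card {- \<lceil>B / \<delta>\<rceil>..\<lceil>B / \<delta>\<rceil>}"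
    unfolding grid_def by (intro card_image_le) auto
  then have "card (grid \<delta> B) \<le> nat (2 * \<lceil>B / \<delta>\<rceil> + 1)"
    by (simp add: algebra_simps)
  moreover have "0 \<le> B / \<delta>"
    using assms by simp
  ultimately show ?thesis
    by linarith
qed

text \<open>Only one factor is rounded, and the error is charged to the L1 norm of the other. Hence
  the precision need not depend on the number of terms.\<close>

lemma sum_round_down_error:
  fixes a c :: "'i \<Rightarrow> real"
  assumes "0 < \<delta>" "(\<Sum>i\<in>I. \<bar>c i\<bar>) \<le> 1"
  shows "\<bar>(\<Sum>i\<in>I. round_down \<delta> (a i) * c i) - (\<Sum>i\<in>I. a i * c i)\<bar> \<le> \<delta>"
proof -
  have "\<bar>(\<Sum>i\<in>I. round_down \<delta> (a i) * c i) - (\<Sum>i\<in>I. a i * c i)\<bar>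
      = \<bar>\<Sum>i\<in>I. (round_down \<delta> (a i) - a i) * c i\<bar>"
    by (simp add: sum_subtractf left_diff_distrib)
  also have "\<dots> \<le> (\<Sum>i\<in>I. \<bar>(round_down \<delta> (a i) - a i) * c i\<bar>)"
    by (rule sum_abs)
  also have "\<dots> \<le> (\<Sum>i\<in>I. \<delta> * \<bar>c i\<bar>)"
    using assms by (intro sum_mono) (auto simp: abs_mult intro!: mult_right_mono round_down_error)
  also have "\<dots> = \<delta> * (\<Sum>i\<in>I. \<bar>c i\<bar>)"
    by (simp add: sum_distrib_left)
  also have "\<dots> \<le> \<delta> * 1"
    using assms by (intro mult_left_mono) auto
  finally show ?thesis
    by simp
qed

text \<open>Hoelder's inequality for the max norm and the L1 norm; it confines the numbers to be
  sent to a bounded grid.\<close>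

lemma abs_sum_mult_le:
  fixes a c :: "'i \<Rightarrow> real"
  assumes "\<And>i. i \<in> I \<Longrightarrow> \<bar>a i\<bar> \<le> 1" "(\<Sum>i\<in>I. \<bar>c i\<bar>) \<le> 1"
  shows "\<bar>\<Sum>i\<in>I. a i * c i\<bar> \<le> 1"
proof -
  have "\<bar>\<Sum>i\<in>I. a i * c i\<bar> \<le> (\<Sum>i\<in>I. \<bar>a i * c i\<bar>)"
    by (rule sum_abs)
  also have "\<dots> \<le> (\<Sum>i\<in>I. 1 * \<bar>c i\<bar>)"
    unfolding abs_mult using assms by (intro sum_mono mult_right_mono) auto
  finally show ?thesis
    using assms by simp
qed

definition sparse_funs :: "nat \<Rightarrow> nat \<Rightarrow> real set \<Rightarrow> (nat \<Rightarrow> real) set" where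
  "sparse_funs M s G = {w. {b. w b \<noteq> 0} \<subseteq> {..<M} \<and> card {b. w b \<noteq> 0} \<le> s \<and> range w \<subseteq> G}"

text \<open>A sparse function is recovered from a list of \<open>s\<close> pairs of position and
  value. A message of this kind thus costs about \<open>s * log 2 (M * card G)\<close> bits, with
  \<open>M\<close> only inside the logarithm.\<close>

lemma sparse_funs_finite_card:
  assumes "0 < M" "finite G"
  shows "finite (sparse_funs M s G)" "card (sparse_funs M s G) \<le> (M * card G) ^ s"
proof -
  define L where "L = {xs. set xs \<subseteq> {..<M} \<times> G \<and> length xs = s}"
  define F :: "(nat \<times> real) list \<Rightarrow> nat \<Rightarrow> real"
    where "F = (\<lambda>xs b. case map_of xs b of None \<Rightarrow> 0 | Some v \<Rightarrow> v)"
  have L: "finite L" "card L = (M * card G) ^ s"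
    unfolding L_def using assms
    by (auto simp: finite_lists_length_eq card_lists_length_eq card_cartesian_product)
  have sub: "sparse_funs M s G \<subseteq> F ` L"
  proof
    fix w assume w: "w \<in> sparse_funs M s G"
    let ?B = "{b. w b \<noteq> 0}"
    have "finite ?B"
      using w by (auto simp: sparse_funs_def intro: finite_subset)
    then obtain bs where bs: "set bs = ?B" "length bs = card ?B"
      by (metis finite_distinct_list distinct_card)
    \<comment> \<open>Short lists are padded with position 0, which is below \<open>M\<close>. The
      padding pairs carry the true value \<open>w 0\<close>, so looking up position 0 stays
      correct.\<close>
    define cs where "cs = bs @ replicate (s - card ?B) 0"
    have cs: "length cs = s" "?B \<subseteq> set cs" "set cs \<subseteq> {..<M}"
      using bs w \<open>0 < M\<close> by (auto simp: cs_def sparse_funs_def)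
    have "map (\<lambda>b. (b, w b)) cs \<in> L"
      using cs w by (auto simp: L_def sparse_funs_def)
    moreover have "F (map (\<lambda>b. (b, w b)) cs) = w"
      using cs by (auto simp: F_def fun_eq_iff map_of_map_restrict restrict_map_def)
    ultimately show "w \<in> F ` L"
      by force
  qed
  show "finite (sparse_funs M s G)"
    using sub L by (auto intro: finite_subset)
  show "card (sparse_funs M s G) \<le> (M * card G) ^ s"
    using surj_card_le[OF L(1) sub] L by simp
qed

section \<open>Bucket sums\<close>

definition bucket :: "'x set \<Rightarrow> ('x \<Rightarrow> nat) \<Rightarrow> ('x \<Rightarrow> real) \<Rightarrow> nat \<Rightarrow> real" where
  "bucket A h v b = (\<Sum>x\<in>A. if h x = b then v x else 0)"

text \<open>Forming bucket sums is adjoint to composing with \<open>h\<close>; exchanging the two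
  sums shows it.\<close>

lemma sum_mult_bucket:
  assumes "finite A" "h ` A \<subseteq> {..<M}"
  shows "(\<Sum>b<M. F b * bucket A h v b) = (\<Sum>x\<in>A. F (h x) * v x)"
proof -
  have "(\<Sum>b<M. F b * bucket A h v b) = (\<Sum>x\<in>A. \<Sum>b<M. if h x = b then F b * v x else 0)"
    unfolding bucket_def sum_distrib_left
    by (subst sum.swap) (intro sum.cong refl, auto)
  also have "\<dots> = (\<Sum>x\<in>A. F (h x) * v x)"
    using assms by (intro sum.cong refl) (auto simp: sum.delta' image_subset_iff)
  finally show ?thesis .
qed

lemma sum_abs_bucket_le:
  assumes "finite A" "h ` A \<subseteq> {..<M}"
  shows "(\<Sum>b<M. \<bar>bucket A h v b\<bar>) \<le> (\<Sum>x\<in>A. \<bar>v x\<bar>)"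
proof -
  \<comment> \<open>The factor 1 makes the right-hand side an instance of
    \<open>sum_mult_bucket\<close> with constant \<open>F\<close>.\<close>
  have "(\<Sum>b<M. \<bar>bucket A h v b\<bar>) \<le> (\<Sum>b<M. 1 * bucket A h (\<lambda>x. \<bar>v x\<bar>) b)"
    unfolding bucket_def by (intro sum_mono) (auto intro!: order.trans[OF sum_abs] sum_mono)
  also have "\<dots> = (\<Sum>x\<in>A. \<bar>v x\<bar>)"
    by (subst sum_mult_bucket[OF assms]) simp
  finally show ?thesis .
qed

lemma abs_bucket_le: "\<bar>bucket A h v b\<bar> \<le> (\<Sum>x\<in>A. \<bar>v x\<bar>)"
  unfolding bucket_def by (intro order.trans[OF sum_abs] sum_mono) auto

text \<open>Used to bound the number of nonzero buckets by the number of heavy points.\<close>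

lemma bucket_nonzero_subset: "{b. bucket A h v b \<noteq> 0} \<subseteq> h ` {x\<in>A. v x \<noteq> 0}"
proof
  fix b assume "b \<in> {b. bucket A h v b \<noteq> 0}"
  then obtain x where "x \<in> A" "(if h x = b then v x else 0) \<noteq> 0"
    unfolding bucket_def by (auto elim: sum.not_neutral_contains_not_neutral)
  then show "b \<in> h ` {x\<in>A. v x \<noteq> 0}"
    by (auto split: if_splits)
qed

text \<open>The off-diagonal excess of the inner product of two bucket vectors over the true inner
  product, see \<open>bucket_inner\<close>.\<close>

definition collision :: "'x set \<Rightarrow> ('x \<Rightarrow> nat) \<Rightarrow> ('x \<Rightarrow> real) \<Rightarrow> ('x \<Rightarrow> real) \<Rightarrow> real" where
  "collision A h v w = (\<Sum>x\<in>A. \<Sum>y\<in>A. if x \<noteq> y \<and> h x = h y then v x * w y else 0)"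

lemma collision_nonneg:
  assumes "\<And>x. x \<in> A \<Longrightarrow> 0 \<le> v x" "\<And>x. x \<in> A \<Longrightarrow> 0 \<le> w x"
  shows "0 \<le> collision A h v w"
  unfolding collision_def using assms by (intro sum_nonneg) auto

lemma bucket_inner:
  assumes "finite A" "h ` A \<subseteq> {..<M}"
  shows "(\<Sum>b<M. bucket A h v b * bucket A h w b) = (\<Sum>x\<in>A. v x * w x) + collision A h v w"
proof -
  have "(\<Sum>b<M. bucket A h v b * bucket A h w b) = (\<Sum>y\<in>A. bucket A h v (h y) * w y)"
    by (rule sum_mult_bucket[OF assms])
  also have "\<dots> = (\<Sum>y\<in>A. \<Sum>x\<in>A. if h x = h y then v x * w y else 0)"
    unfolding bucket_def sum_distrib_right by (intro sum.cong refl) auto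
  also have "\<dots> = (\<Sum>x\<in>A. \<Sum>y\<in>A. if h x = h y then v x * w y else 0)"
    by (rule sum.swap)
  also have "\<dots> = (\<Sum>x\<in>A. \<Sum>y\<in>A. (if x = y then v x * w y else 0)
      + (if x \<noteq> y \<and> h x = h y then v x * w y else 0))"
    by (intro sum.cong refl) auto
  also have "\<dots> = (\<Sum>x\<in>A. v x * w x) + collision A h v w"
    using assms by (simp add: sum.distrib collision_def)
  finally show ?thesis .
qed

section \<open>Random hashing and CountSketch\<close>

text \<open>In \<open>sketch A u v\<close>, \<open>u\<close> gives each coordinate its bucket and its sign.\<close>

definition sketch :: "'x set \<Rightarrow> ('x \<Rightarrow> nat \<times> real) \<Rightarrow> ('x \<Rightarrow> real) \<Rightarrow> nat \<Rightarrow> real" where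
  "sketch A u v = bucket A (\<lambda>x. fst (u x)) (\<lambda>x. snd (u x) * v x)"

definition sketch_error ::
  "nat \<Rightarrow> 'x set \<Rightarrow> ('x \<Rightarrow> nat \<times> real) \<Rightarrow> ('x \<Rightarrow> real) \<Rightarrow> ('x \<Rightarrow> real) \<Rightarrow> real" where
  "sketch_error t A u v w = (\<Sum>i<t. sketch A u v i * sketch A u w i) - (\<Sum>x\<in>A. v x * w x)"

text \<open>All coordinates are independent; shared randomness is not charged, so no small hash
  family is called for.\<close>

definition random_hash :: "'x set \<Rightarrow> nat \<Rightarrow> ('x \<Rightarrow> nat) pmf" where
  "random_hash A M = Pi_pmf A 0 (\<lambda>_. pmf_of_set {..<M})"

definition random_sketch :: "'x set \<Rightarrow> nat \<Rightarrow> ('x \<Rightarrow> nat \<times> real) pmf" where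
  "random_sketch A t = Pi_pmf A (0, 1) (\<lambda>_. pmf_of_set ({..<t} \<times> {-1, 1}))"

section \<open>Expectations over finitely supported product distributions\<close>

lemma finite_set_Pi_pmf:
  assumes "finite A" "\<And>x. x \<in> A \<Longrightarrow> finite (set_pmf (p x))"
  shows "finite (set_pmf (Pi_pmf A d p))"
  using assms by (auto simp: set_Pi_pmf intro!: finite_PiE_dflt)

text \<open>Fubini for a single coordinate, with the draw at \<open>x\<close> innermost: everything
  else is fixed while \<open>x\<close> is averaged. This drives the inductions over the coordinate
  set.\<close>

lemma expectation_Pi_pmf_insert:
  fixes F :: "('x \<Rightarrow> 'y) \<Rightarrow> real"
  assumes "finite A" "x \<notin> A" "\<And>y. finite (set_pmf (p y))"
  shows "measure_pmf.expectation (Pi_pmf (insert x A) d p) F =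
    measure_pmf.expectation (Pi_pmf A d p)
      (\<lambda>f. measure_pmf.expectation (p x) (\<lambda>y. F (f(x := y))))"
proof -
  have "Pi_pmf (insert x A) d p = Pi_pmf A d p \<bind> (\<lambda>f. map_pmf (\<lambda>y. f(x := y)) (p x))"
    unfolding Pi_pmf_insert'[OF assms(1,2)] map_pmf_def by (rule bind_commute_pmf)
  moreover have fin: "finite (set_pmf (Pi_pmf A d p))"
    using assms by (intro finite_set_Pi_pmf)
  ultimately have "measure_pmf.expectation (Pi_pmf (insert x A) d p) F =
      (\<Sum>f\<in>set_pmf (Pi_pmf A d p). pmf (Pi_pmf A d p) f *\<^sub>R
        measure_pmf.expectation (map_pmf (\<lambda>y. f(x := y)) (p x)) F)"
    using assms(3) by (simp only:) (rule pmf_expectation_bind, auto)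
  also have "\<dots> = measure_pmf.expectation (Pi_pmf A d p)
      (\<lambda>f. measure_pmf.expectation (p x) (\<lambda>y. F (f(x := y))))"
    by (subst integral_measure_pmf[OF fin]) auto
  finally show ?thesis .
qed

lemma expectation_sum_finite:
  fixes F :: "'i \<Rightarrow> 'x \<Rightarrow> real"
  assumes "finite (set_pmf P)"
  shows "measure_pmf.expectation P (\<lambda>x. \<Sum>i\<in>I. F i x) = (\<Sum>i\<in>I. measure_pmf.expectation P (F i))"
  using assms by (intro Bochner_Integration.integral_sum integrable_measure_pmf_finite)

lemma expectation_mono_finite:
  fixes F G :: "'x \<Rightarrow> real"
  assumes "finite (set_pmf P)" "\<And>x. x \<in> set_pmf P \<Longrightarrow> F x \<le> G x"
  shows "measure_pmf.expectation P F \<le> measure_pmf.expectation P G"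
  using assms by (intro integral_mono_AE integrable_measure_pmf_finite) (auto simp: AE_measure_pmf_iff)

lemma set_random_hash:
  assumes "finite A" "0 < M"
  shows "finite (set_pmf (random_hash A M))"
    and "h \<in> set_pmf (random_hash A M) \<Longrightarrow> h ` A \<subseteq> {..<M}"
proof -
  have *: "set_pmf (pmf_of_set {..<M}) = {..<M}"
    using assms by (intro set_pmf_of_set) auto
  then show "finite (set_pmf (random_hash A M))"
    unfolding random_hash_def using assms by (intro finite_set_Pi_pmf) auto
  show "h ` A \<subseteq> {..<M}" if "h \<in> set_pmf (random_hash A M)"
    using that assms * by (auto simp: random_hash_def set_Pi_pmf PiE_dflt_def)
qed

lemma set_random_sketch:
  assumes "finite A" "0 < t"
  shows "finite (set_pmf (random_sketch A t))"
    and "u \<in> set_pmf (random_sketch A t) \<Longrightarrow> u ` A \<subseteq> {..<t} \<times> {-1, 1}"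
proof -
  have *: "set_pmf (pmf_of_set ({..<t} \<times> {-1, 1::real})) = {..<t} \<times> {-1, 1}"
    using assms by (intro set_pmf_of_set) auto
  then show "finite (set_pmf (random_sketch A t))"
    unfolding random_sketch_def using assms by (intro finite_set_Pi_pmf) auto
  show "u ` A \<subseteq> {..<t} \<times> {-1, 1}" if "u \<in> set_pmf (random_sketch A t)"
    using that assms * by (auto simp: random_sketch_def set_Pi_pmf PiE_dflt_def)
qed

section \<open>Expected weight of hash collisions\<close>

text \<open>With all buckets but that of \<open>x\<close> fixed, \<open>h y\<close> is a constant,
  and the uniform bucket of \<open>x\<close> hits it with probability at most
  \<open>1 / M\<close>.\<close>

lemma prob_hash_eq_le:
  assumes "finite A" "0 < M" "x \<in> A" "x \<noteq> y"
  shows "measure_pmf.expectation (random_hash A M) (\<lambda>h. of_bool (h x = h y)) \<le> 1 / real M"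
proof -
  have A: "insert x (A - {x}) = A"
    using assms by auto
  have fin: "finite (set_pmf (random_hash (A - {x}) M))"
    using assms by (intro set_random_hash) auto
  have "measure_pmf.expectation (random_hash A M) (\<lambda>h. of_bool (h x = h y) :: real) =
    measure_pmf.expectation (random_hash (A - {x}) M)
      (\<lambda>h. measure_pmf.expectation (pmf_of_set {..<M}) (\<lambda>b. of_bool (b = h y)))"
    unfolding random_hash_def using assms
    by (subst A[symmetric], subst expectation_Pi_pmf_insert) (auto simp: lessThan_empty_iff)
  also have "\<dots> \<le> measure_pmf.expectation (random_hash (A - {x}) M) (\<lambda>h. 1 / real M)"
  proof (rule expectation_mono_finite[OF fin])
    fix h :: "'a \<Rightarrow> nat"
    have "measure_pmf.expectation (pmf_of_set {..<M}) (\<lambda>b. of_bool (b = h y) :: real)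
        = (\<Sum>b<M. of_bool (b = h y)) / real M"
      using assms by (subst integral_pmf_of_set) (auto simp: lessThan_empty_iff)
    also have "(\<Sum>b<M. of_bool (b = h y) :: real) \<le> 1"
      by (simp add: of_bool_def)
    finally show "measure_pmf.expectation (pmf_of_set {..<M}) (\<lambda>b. of_bool (b = h y)) \<le> 1 / real M"
      by (simp add: divide_right_mono)
  qed
  finally show ?thesis
    by simp
qed

text \<open>Linearity over pairs of points. For probability vectors the bound is
  \<open>1 / M\<close> however many points there are, which is why \<open>n\<close> drops
  out.\<close>

lemma expectation_collision_le:
  assumes "finite A" "0 < M" "\<And>x. x \<in> A \<Longrightarrow> 0 \<le> v x" "\<And>x. x \<in> A \<Longrightarrow> 0 \<le> w x"
  shows "measure_pmf.expectation (random_hash A M) (\<lambda>h. collision A h v w)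
    \<le> sum v A * sum w A / real M"
proof -
  have fin: "finite (set_pmf (random_hash A M))"
    using assms by (intro set_random_hash)
  have "measure_pmf.expectation (random_hash A M) (\<lambda>h. collision A h v w)
    = measure_pmf.expectation (random_hash A M) (\<lambda>h. \<Sum>x\<in>A. \<Sum>y\<in>A.
        (if x \<noteq> y then v x * w y else 0) * of_bool (h x = h y))"
    unfolding collision_def by (intro Bochner_Integration.integral_cong refl sum.cong) auto
  also have "\<dots> = (\<Sum>x\<in>A. \<Sum>y\<in>A. (if x \<noteq> y then v x * w y else 0) *
      measure_pmf.expectation (random_hash A M) (\<lambda>h. of_bool (h x = h y)))"
    by (simp add: expectation_sum_finite[OF fin])
  also have "\<dots> \<le> (\<Sum>x\<in>A. \<Sum>y\<in>A. v x * w y * (1 / real M))"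
  proof (intro sum_mono)
    fix x y assume "x \<in> A" "y \<in> A"
    then show "(if x \<noteq> y then v x * w y else 0) *
        measure_pmf.expectation (random_hash A M) (\<lambda>h. of_bool (h x = h y))
      \<le> v x * w y * (1 / real M)"
      using assms mult_left_mono[OF prob_hash_eq_le[of A M x y], of "v x * w y"] by simp
  qed
  also have "\<dots> = sum v A * sum w A / real M"
    by (simp add: sum_product sum_divide_distrib)
  finally show ?thesis .
qed

section \<open>Second moment of the CountSketch error\<close>

text \<open>The two signs of a bucket are paired so that terms odd in the sign cancel within each
  summand.\<close>

lemma expectation_bucket_sign:
  fixes F :: "nat \<times> real \<Rightarrow> real"
  assumes "0 < t"
  shows "measure_pmf.expectation (pmf_of_set ({..<t} \<times> {-1, 1})) F
    = (\<Sum>j<t. F (j, -1) + F (j, 1)) / (2 * real t)"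
proof -
  have "measure_pmf.expectation (pmf_of_set ({..<t} \<times> {-1, 1})) F
      = sum F ({..<t} \<times> {-1, 1}) / real (card ({..<t} \<times> {-1, 1::real}))"
    using assms by (intro integral_pmf_of_set) auto
  also have "sum F ({..<t} \<times> {-1, 1}) = (\<Sum>j<t. F (j, -1) + F (j, 1))"
    using sum.cartesian_product[of "\<lambda>j \<sigma>. F (j, \<sigma>)" "{-1, 1}" "{..<t}"] by simp
  finally show ?thesis
    by (simp add: card_cartesian_product mult.commute)
qed

lemma expectation_random_sketch_insert:
  fixes F :: "('x \<Rightarrow> nat \<times> real) \<Rightarrow> real"
  assumes "finite A" "x \<notin> A" "0 < t"
  shows "measure_pmf.expectation (random_sketch (insert x A) t) F =
    measure_pmf.expectation (random_sketch A t)
      (\<lambda>u. (\<Sum>j<t. F (u(x := (j, -1))) + F (u(x := (j, 1)))) / (2 * real t))"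
proof -
  have "finite (set_pmf (pmf_of_set ({..<t} \<times> {-1, 1::real})))"
    using assms by (subst set_pmf_of_set) auto
  then show ?thesis
    unfolding random_sketch_def using assms
    by (subst expectation_Pi_pmf_insert) (auto simp: expectation_bucket_sign)
qed

lemma sketch_insert:
  assumes "finite A" "x \<notin> A"
  shows "sketch (insert x A) (u(x := (j, \<sigma>))) v i
    = sketch A u v i + (if j = i then \<sigma> * v x else 0)"
proof -
  have "sketch A (u(x := (j, \<sigma>))) v i = sketch A u v i"
    unfolding sketch_def bucket_def using assms by (intro sum.cong) auto
  then show ?thesis
    using assms by (simp add: sketch_def bucket_def)
qed

text \<open>Only bucket \<open>j\<close> changes. The mixed products are linear in the sign, while
  \<open>\<sigma> * \<sigma> = 1\<close> turns the remaining product into exactly the new term of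
  the true inner product.\<close>

lemma inner_sketch_insert:
  assumes "finite A" "x \<notin> A" "j < t" "\<sigma> * \<sigma> = 1"
  shows "(\<Sum>i<t. sketch (insert x A) (u(x := (j, \<sigma>))) v i * sketch (insert x A) (u(x := (j, \<sigma>))) w i)
    = (\<Sum>i<t. sketch A u v i * sketch A u w i)
      + \<sigma> * (v x * sketch A u w j + w x * sketch A u v j) + v x * w x"
proof -
  have "(\<Sum>i<t. sketch (insert x A) (u(x := (j, \<sigma>))) v i * sketch (insert x A) (u(x := (j, \<sigma>))) w i)
    = (\<Sum>i<t. sketch A u v i * sketch A u w i + (if j = i then
        \<sigma> * (v x * sketch A u w i + w x * sketch A u v i) + (\<sigma> * \<sigma>) * (v x * w x) else 0))"
    using assms(1,2) by (intro sum.cong refl) (auto simp: sketch_insert algebra_simps)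
  then show ?thesis
    using assms(3,4) by (simp add: sum.distrib)
qed

text \<open>The case \<open>v = w\<close> of \<open>inner_sketch_insert\<close>, where averaging
  over the sign removes the mixed term. It evaluates the sketch norms that arise in the second
  moment.\<close>

lemma expectation_sketch_norm:
  assumes "finite A" "0 < t"
  shows "measure_pmf.expectation (random_sketch A t) (\<lambda>u. \<Sum>i<t. (sketch A u v i)\<^sup>2)
    = (\<Sum>x\<in>A. (v x)\<^sup>2)"
  using assms(1)
proof (induction A)
  case empty
  then show ?case
    by (simp add: sketch_def bucket_def)
next
  case (insert x A)
  have fin: "finite (set_pmf (random_sketch A t))"
    using insert assms by (intro set_random_sketch)
  have "(\<Sum>j<t. (\<Sum>i<t. (sketch (insert x A) (u(x := (j, -1))) v i)\<^sup>2)
        + (\<Sum>i<t. (sketch (insert x A) (u(x := (j, 1))) v i)\<^sup>2)) / (2 * real t)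
      = (\<Sum>i<t. (sketch A u v i)\<^sup>2) + (v x)\<^sup>2" for u
    using insert assms by (simp add: power2_eq_square inner_sketch_insert field_simps)
  then show ?case
    using insert assms
    by (simp add: expectation_random_sketch_insert Bochner_Integration.integral_add
        integrable_measure_pmf_finite[OF fin])
qed

lemma expectation_sketch_error_le:
  assumes "finite A" "0 < t"
  shows "measure_pmf.expectation (random_sketch A t) (\<lambda>u. (sketch_error t A u v w)\<^sup>2)
    \<le> 2 / real t * (\<Sum>x\<in>A. (v x)\<^sup>2) * (\<Sum>x\<in>A. (w x)\<^sup>2)"
  using assms(1)
proof (induction A)
  case empty
  then show ?case
    by (simp add: sketch_error_def sketch_def bucket_def)
next
  case (insert x A)
  let ?E = "measure_pmf.expectation (random_sketch A t)"
  let ?D = "\<lambda>u. sketch_error t A u v w"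
  let ?P = "\<lambda>u. \<Sum>i<t. (sketch A u v i)\<^sup>2" and ?Q = "\<lambda>u. \<Sum>i<t. (sketch A u w i)\<^sup>2"
  let ?V = "\<Sum>x\<in>A. (v x)\<^sup>2" and ?W = "\<Sum>x\<in>A. (w x)\<^sup>2"
  have fin: "finite (set_pmf (random_sketch A t))"
    using insert assms by (intro set_random_sketch)
  have step: "(\<Sum>j<t. (sketch_error t (insert x A) (u(x := (j, -1))) v w)\<^sup>2
        + (sketch_error t (insert x A) (u(x := (j, 1))) v w)\<^sup>2) / (2 * real t)
      \<le> (?D u)\<^sup>2 + (2 / real t * (v x)\<^sup>2 * ?Q u + 2 / real t * (w x)\<^sup>2 * ?P u)" for u
  proof -
    define c where "c j = v x * sketch A u w j + w x * sketch A u v j" for j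
    \<comment> \<open>The new term \<open>v x * w x\<close> occurs both in the sketched and in the
      true inner product and cancels, so the error moves only by the signed mixed term.\<close>
    have err: "sketch_error t (insert x A) (u(x := (j, \<sigma>))) v w = ?D u + \<sigma> * c j"
      if "j < t" "\<sigma> * \<sigma> = 1" for j \<sigma>
      using that insert by (simp add: sketch_error_def inner_sketch_insert c_def)
    \<comment> \<open>Adding the squares for both signs removes the product of \<open>?D u\<close>
      and \<open>c j\<close>.\<close>
    have "(\<Sum>j<t. (sketch_error t (insert x A) (u(x := (j, -1))) v w)\<^sup>2
        + (sketch_error t (insert x A) (u(x := (j, 1))) v w)\<^sup>2)
      = (\<Sum>j<t. 2 * (?D u)\<^sup>2 + 2 * (c j)\<^sup>2)"
      by (intro sum.cong refl) (simp add: err power2_eq_square algebra_simps)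
    also have "\<dots> \<le> (\<Sum>j<t. 2 * (?D u)\<^sup>2 +
        2 * (2 * (v x)\<^sup>2 * (sketch A u w j)\<^sup>2 + 2 * (w x)\<^sup>2 * (sketch A u v j)\<^sup>2))"
    proof (intro sum_mono add_left_mono mult_left_mono)
      fix j
      \<comment> \<open>The square of a sum is at most twice the sum of the squares, because the
        square of the difference is nonnegative.\<close>
      have "0 \<le> (v x * sketch A u w j - w x * sketch A u v j)\<^sup>2"
        by simp
      then show "(c j)\<^sup>2 \<le> 2 * (v x)\<^sup>2 * (sketch A u w j)\<^sup>2 + 2 * (w x)\<^sup>2 * (sketch A u v j)\<^sup>2"
        unfolding c_def power2_sum power2_diff power_mult_distrib by linarith
    qed simp
    also have "\<dots> = 2 * real t * (?D u)\<^sup>2 + 4 * (v x)\<^sup>2 * ?Q u + 4 * (w x)\<^sup>2 * ?P u"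
      by (simp add: sum.distrib sum_distrib_left algebra_simps)
    finally show ?thesis
      using assms by (simp add: field_simps)
  qed
  have "measure_pmf.expectation (random_sketch (insert x A) t)
        (\<lambda>u. (sketch_error t (insert x A) u v w)\<^sup>2)
      \<le> ?E (\<lambda>u. (?D u)\<^sup>2 + (2 / real t * (v x)\<^sup>2 * ?Q u + 2 / real t * (w x)\<^sup>2 * ?P u))"
    unfolding expectation_random_sketch_insert[OF insert(1,2) assms(2)]
    by (intro expectation_mono_finite[OF fin] step)
  also have "\<dots> = ?E (\<lambda>u. (?D u)\<^sup>2)
      + (2 / real t * (v x)\<^sup>2 * ?E ?Q + 2 / real t * (w x)\<^sup>2 * ?E ?P)"
    by (simp only: Bochner_Integration.integral_add integral_mult_right_zero
        integrable_measure_pmf_finite[OF fin])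
  also have "\<dots> \<le> 2 / real t * ?V * ?W + (2 / real t * (v x)\<^sup>2 * ?W + 2 / real t * (w x)\<^sup>2 * ?V)"
    using insert assms by (simp add: expectation_sketch_norm)
  \<comment> \<open>The expanded right-hand side exceeds the left by the nonnegative term
    \<open>2 / real t * (v x)\<^sup>2 * (w x)\<^sup>2\<close>.\<close>
  also have "\<dots> \<le> 2 / real t * ((v x)\<^sup>2 + ?V) * ((w x)\<^sup>2 + ?W)"
    by (simp add: algebra_simps add_divide_distrib)
  finally show ?case
    using insert by simp
qed

section \<open>The protocol\<close>

definition heavy :: "real \<Rightarrow> ('x \<Rightarrow> real) \<Rightarrow> 'x \<Rightarrow> real" where
  "heavy \<tau> v x = (if \<tau> \<le> v x then v x else 0)"

definition light :: "real \<Rightarrow> ('x \<Rightarrow> real) \<Rightarrow> 'x \<Rightarrow> real" where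
  "light \<tau> v x = (if \<tau> \<le> v x then 0 else v x)"

lemma heavy_light:
  assumes "0 \<le> v x"
  shows "0 \<le> heavy \<tau> v x" "0 \<le> light \<tau> v x" "heavy \<tau> v x \<le> v x" "light \<tau> v x \<le> v x"
    "heavy \<tau> v x + light \<tau> v x = v x"
  using assms by (auto simp: heavy_def light_def)

text \<open>Each heavy point takes at least \<open>\<tau>\<close> of a total mass of at most
  1.\<close>

lemma card_heavy_le:
  assumes "finite A" "0 < \<tau>" "\<And>x. x \<in> A \<Longrightarrow> 0 \<le> v x" "sum v A \<le> 1"
  shows "card {x\<in>A. heavy \<tau> v x \<noteq> 0} \<le> nat \<lfloor>1 / \<tau>\<rfloor>"
proof -
  let ?H = "{x\<in>A. heavy \<tau> v x \<noteq> 0}"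
  have "real (card ?H) * \<tau> = (\<Sum>x\<in>?H. \<tau>)"
    by simp
  also have "\<dots> \<le> (\<Sum>x\<in>?H. v x)"
    by (intro sum_mono) (auto simp: heavy_def split: if_splits)
  also have "\<dots> \<le> sum v A"
    using assms by (intro sum_mono2) auto
  finally have "real (card ?H) \<le> 1 / \<tau>"
    using assms by (simp add: field_simps)
  then show ?thesis
    by (simp add: le_nat_floor)
qed

text \<open>A light value is below \<open>\<tau>\<close>, so its square is at most
  \<open>\<tau>\<close> times the value itself.\<close>

lemma sum_light_square_le:
  assumes "finite A" "0 < \<tau>" "\<And>x. x \<in> A \<Longrightarrow> 0 \<le> v x" "sum v A \<le> 1"
  shows "(\<Sum>x\<in>A. (light \<tau> v x)\<^sup>2) \<le> \<tau>"
proof -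
  have "(\<Sum>x\<in>A. (light \<tau> v x)\<^sup>2) \<le> (\<Sum>x\<in>A. \<tau> * v x)"
    using assms by (intro sum_mono) (auto simp: light_def power2_eq_square intro!: mult_right_mono)
  also have "\<dots> = \<tau> * sum v A"
    by (simp add: sum_distrib_left)
  also have "\<dots> \<le> \<tau> * 1"
    using assms by (intro mult_left_mono) auto
  finally show ?thesis
    by simp
qed

text \<open>\<open>R1\<close> is what Bob computes from Alice's rounded heavy buckets and rounded
  light sketch: heavy \<open>v\<close> against all of \<open>w\<close>, plus light against light.
  \<open>R2\<close> is what Alice adds from Bob's rounded heavy buckets: light \<open>v\<close>
  against heavy \<open>w\<close>. Three rounded vectors account for
  \<open>3 * \<delta>\<close>.\<close>

lemma inner_product_estimate:
  fixes v w :: "'x \<Rightarrow> real" and \<tau> :: real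
  assumes A: "finite A" and h: "h ` A \<subseteq> {..<M}" and u: "u ` A \<subseteq> {..<t} \<times> {-1, 1}"
    and \<delta>: "0 < \<delta>" "\<delta> \<le> 1"
    and v: "\<And>x. x \<in> A \<Longrightarrow> 0 \<le> v x" "sum v A \<le> 1"
    and w: "\<And>x. x \<in> A \<Longrightarrow> 0 \<le> w x" "sum w A \<le> 1"
  defines "R1 \<equiv> (\<Sum>b<M. round_down \<delta> (bucket A h (heavy \<tau> v) b) * bucket A h w b)
      + (\<Sum>i<t. round_down \<delta> (sketch A u (light \<tau> v) i) * sketch A u (light \<tau> w) i)"
    and "R2 \<equiv> (\<Sum>b<M. round_down \<delta> (bucket A h (heavy \<tau> w) b) * bucket A h (light \<tau> v) b)"
  shows "\<And>b. \<bar>bucket A h (heavy \<tau> v) b\<bar> \<le> 1" "\<And>b. \<bar>bucket A h (heavy \<tau> w) b\<bar> \<le> 1"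
    "\<And>i. \<bar>sketch A u (light \<tau> v) i\<bar> \<le> 1" "\<bar>R1\<bar> \<le> 4" "\<bar>R2\<bar> \<le> 4"
    "\<bar>R1 + R2 - (\<Sum>x\<in>A. v x * w x)\<bar>
      \<le> 3 * \<delta> + collision A h v w + \<bar>sketch_error t A u (light \<tau> v) (light \<tau> w)\<bar>"
proof -
  have abs_le_1: "(\<Sum>x\<in>A. \<bar>g x\<bar>) \<le> 1"
    if "\<And>x. x \<in> A \<Longrightarrow> \<bar>g x\<bar> \<le> f x" "sum f A \<le> 1" for f g :: "'x \<Rightarrow> real"
    using that by (meson sum_mono order.trans)
  have sgn: "\<bar>snd (u x) * z\<bar> = \<bar>z\<bar>" if "x \<in> A" for x z
    using u that by (force simp: abs_mult image_subset_iff mem_Times_iff)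
  have fu: "(\<lambda>x. fst (u x)) ` A \<subseteq> {..<t}"
    using u by (auto simp: image_subset_iff mem_Times_iff)
  have Hv: "(\<Sum>x\<in>A. \<bar>heavy \<tau> v x\<bar>) \<le> 1" and Lv: "(\<Sum>x\<in>A. \<bar>light \<tau> v x\<bar>) \<le> 1"
    by (rule abs_le_1[of _ v]; use v in \<open>simp add: heavy_light\<close>)+
  have Hw: "(\<Sum>x\<in>A. \<bar>heavy \<tau> w x\<bar>) \<le> 1" and Lw: "(\<Sum>x\<in>A. \<bar>light \<tau> w x\<bar>) \<le> 1"
    and W: "(\<Sum>x\<in>A. \<bar>w x\<bar>) \<le> 1"
    by (rule abs_le_1[of _ w]; use w in \<open>simp add: heavy_light\<close>)+
  have SLv: "(\<Sum>x\<in>A. \<bar>snd (u x) * light \<tau> v x\<bar>) \<le> 1"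
    and SLw: "(\<Sum>x\<in>A. \<bar>snd (u x) * light \<tau> w x\<bar>) \<le> 1"
    using Lv Lw by (simp_all add: sgn)
  show b1: "\<bar>bucket A h (heavy \<tau> v) b\<bar> \<le> 1" for b
    using abs_bucket_le Hv by (rule order.trans)
  show b2: "\<bar>bucket A h (heavy \<tau> w) b\<bar> \<le> 1" for b
    using abs_bucket_le Hw by (rule order.trans)
  show b3: "\<bar>sketch A u (light \<tau> v) i\<bar> \<le> 1" for i
    unfolding sketch_def using abs_bucket_le SLv by (rule order.trans)
  have c1: "(\<Sum>b<M. \<bar>bucket A h w b\<bar>) \<le> 1"
    using sum_abs_bucket_le[OF A h] W by (rule order.trans)
  have c2: "(\<Sum>b<M. \<bar>bucket A h (light \<tau> v) b\<bar>) \<le> 1"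
    using sum_abs_bucket_le[OF A h] Lv by (rule order.trans)
  have c3: "(\<Sum>i<t. \<bar>sketch A u (light \<tau> w) i\<bar>) \<le> 1"
    unfolding sketch_def using sum_abs_bucket_le[OF A fu] SLw by (rule order.trans)
  define X1 where "X1 = (\<Sum>b<M. bucket A h (heavy \<tau> v) b * bucket A h w b)"
  define X2 where "X2 = (\<Sum>i<t. sketch A u (light \<tau> v) i * sketch A u (light \<tau> w) i)"
  define X3 where "X3 = (\<Sum>b<M. bucket A h (heavy \<tau> w) b * bucket A h (light \<tau> v) b)"
  have X: "\<bar>X1\<bar> \<le> 1" "\<bar>X2\<bar> \<le> 1" "\<bar>X3\<bar> \<le> 1"
    unfolding X1_def X2_def X3_def by (intro abs_sum_mult_le b1 b2 b3 c1 c2 c3)+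
  have R1: "\<bar>R1 - (X1 + X2)\<bar> \<le> 2 * \<delta>"
    using sum_round_down_error[OF \<delta>(1) c1, of "bucket A h (heavy \<tau> v)"]
      sum_round_down_error[OF \<delta>(1) c3, of "sketch A u (light \<tau> v)"]
    unfolding R1_def X1_def X2_def by linarith
  have R2: "\<bar>R2 - X3\<bar> \<le> \<delta>"
    using sum_round_down_error[OF \<delta>(1) c2, of "bucket A h (heavy \<tau> w)"]
    unfolding R2_def X3_def .
  \<comment> \<open>\<open>X1 + X2\<close> is at most 2 in absolute value and rounding adds at most
    \<open>2 * \<delta> \<le> 2\<close>. The same bound is kept for \<open>R2\<close> so that one
    grid serves all messages.\<close>
  show "\<bar>R1\<bar> \<le> 4" "\<bar>R2\<bar> \<le> 4"
    using R1 R2 X \<delta> by linarith+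
  have X1: "X1 = (\<Sum>x\<in>A. heavy \<tau> v x * w x) + collision A h (heavy \<tau> v) w"
    unfolding X1_def by (rule bucket_inner[OF A h])
  have X3: "X3 = (\<Sum>x\<in>A. light \<tau> v x * heavy \<tau> w x) + collision A h (light \<tau> v) (heavy \<tau> w)"
    unfolding X3_def by (subst bucket_inner[OF A h, symmetric]) (simp add: mult.commute)
  have X2: "X2 = (\<Sum>x\<in>A. light \<tau> v x * light \<tau> w x)
      + sketch_error t A u (light \<tau> v) (light \<tau> w)"
    unfolding X2_def sketch_error_def by simp
  have inner: "(\<Sum>x\<in>A. v x * w x) = (\<Sum>x\<in>A. heavy \<tau> v x * w x)
      + (\<Sum>x\<in>A. light \<tau> v x * heavy \<tau> w x) + (\<Sum>x\<in>A. light \<tau> v x * light \<tau> w x)"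
    unfolding sum.distrib[symmetric] by (intro sum.cong refl) (auto simp: heavy_def light_def)
  \<comment> \<open>The two hashed products cover different parts of \<open>v x * w y\<close>, so
    their collisions together stay within those of the full vectors.\<close>
  have "collision A h (heavy \<tau> v) w + collision A h (light \<tau> v) (heavy \<tau> w) \<le> collision A h v w"
    unfolding collision_def sum.distrib[symmetric]
  proof (intro sum_mono)
    fix x y assume xy: "x \<in> A" "y \<in> A"
    have "heavy \<tau> v x * w y + light \<tau> v x * heavy \<tau> w y \<le> heavy \<tau> v x * w y + light \<tau> v x * w y"
      using v(1)[OF xy(1)] w(1)[OF xy(2)] by (intro add_left_mono mult_left_mono) (auto simp: heavy_light)
    also have "\<dots> = v x * w y"
      using heavy_light(5)[of v x \<tau>, OF v(1)[OF xy(1)]] by (simp add: distrib_right[symmetric])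
    finally show "(if x \<noteq> y \<and> h x = h y then heavy \<tau> v x * w y else 0)
        + (if x \<noteq> y \<and> h x = h y then light \<tau> v x * heavy \<tau> w y else 0)
        \<le> (if x \<noteq> y \<and> h x = h y then v x * w y else 0)"
      by simp
  qed
  moreover have "0 \<le> collision A h (heavy \<tau> v) w" "0 \<le> collision A h (light \<tau> v) (heavy \<tau> w)"
    using v w by (auto intro!: collision_nonneg simp: heavy_light)
  ultimately show "\<bar>R1 + R2 - (\<Sum>x\<in>A. v x * w x)\<bar>
      \<le> 3 * \<delta> + collision A h v w + \<bar>sketch_error t A u (light \<tau> v) (light \<tau> w)\<bar>"
    using R1 R2 X1 X2 X3 inner by linarith
qed

section \<open>Equality as an inner product, and the protocol for a fixed hash and sketch\<close>

lemma finite_bitstrings: "finite (bitstrings n)"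
  using finite_lists_length_eq[of "UNIV :: bool set" n] by (simp add: bitstrings_def)

lemma sum_pmf_dists: "p \<in> dists n \<Longrightarrow> sum (pmf p) (bitstrings n) = 1"
  by (intro sum_pmf_eq_1 finite_bitstrings) (simp add: dists_def)

lemma expectation_EQ_fun:
  assumes "p \<in> dists n" "q \<in> dists n"
  shows "measure_pmf.expectation (pair_pmf p q) (\<lambda>(x, y). EQ_fun x y)
    = (\<Sum>x\<in>bitstrings n. pmf p x * pmf q x)"
proof -
  let ?A = "bitstrings n"
  have "measure_pmf.expectation (pair_pmf p q) (\<lambda>(x, y). EQ_fun x y)
      = (\<Sum>z\<in>?A \<times> ?A. pmf (pair_pmf p q) z *\<^sub>R (\<lambda>(x, y). EQ_fun x y) z)"
    using assms by (intro integral_measure_pmf) (auto simp: finite_bitstrings dists_def)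
  also have "\<dots> = (\<Sum>x\<in>?A. \<Sum>y\<in>?A. pmf p x * pmf q y * EQ_fun x y)"
    unfolding sum.cartesian_product by (intro sum.cong refl) (auto simp: pmf_pair)
  also have "\<dots> = (\<Sum>x\<in>?A. \<Sum>y\<in>?A. if x = y then pmf p x * pmf q y else 0)"
    by (intro sum.cong refl) (auto simp: EQ_fun_def)
  also have "\<dots> = (\<Sum>x\<in>?A. pmf p x * pmf q x)"
    by (simp add: finite_bitstrings)
  finally show ?thesis .
qed

text \<open>A pair of bucket and value costs \<open>2 * c\<close> bits, a number from the grid
  \<open>c\<close> bits. Two heavy messages, one sketch and two scalars give
  \<open>c * (4 * s + t + 2)\<close>. The error \<open>5 * \<delta>\<close> consists of
  \<open>3 * \<delta>\<close> from \<open>inner_product_estimate\<close> and \<open>\<delta>\<close>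
  for rounding each of the two scalars.\<close>

lemma protocol_for_hash_and_sketch:
  fixes \<tau> :: real and n :: nat
  defines "A \<equiv> bitstrings n" and "s \<equiv> nat \<lfloor>1 / \<tau>\<rfloor>"
  assumes h: "h ` A \<subseteq> {..<M}" and u: "u ` A \<subseteq> {..<t} \<times> {-1, 1}"
    and \<delta>: "0 < \<delta>" "\<delta> \<le> 1" and \<tau>: "0 < \<tau>"
    and M: "0 < M" "M \<le> 2 ^ c" and G: "card (grid \<delta> 4) \<le> 2 ^ c"
  shows "\<exists>T. depth T \<le> c * (4 * s + t + 2) \<and> (\<forall>p\<in>dists n. \<forall>q\<in>dists n.
    \<bar>run T p q - (\<Sum>x\<in>A. pmf p x * pmf q x)\<bar> \<le> 5 * \<delta> + collision A h (pmf p) (pmf q)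
      + \<bar>sketch_error t A u (light \<tau> (pmf p)) (light \<tau> (pmf q))\<bar>)"
proof -
  define G where "G = grid \<delta> 4"
  define W where "W = sparse_funs M s G"
  have A: "finite A"
    by (simp add: A_def finite_bitstrings)
  have fG: "finite G" and cG: "card G \<le> 2 ^ c"
    using G by (simp_all add: G_def)
  have fW: "finite W"
    unfolding W_def by (rule sparse_funs_finite_card[OF M(1) fG])
  have "card W \<le> (M * card G) ^ s"
    unfolding W_def by (rule sparse_funs_finite_card[OF M(1) fG])
  also have "\<dots> \<le> (2 ^ c * 2 ^ c) ^ s"
    using M cG by (intro power_mono mult_mono) auto
  also have "\<dots> = 2 ^ (2 * c * s)"
    by (simp add: power_add[symmetric] power_mult[symmetric] mult_2)
  finally have cW: "card W \<le> 2 ^ (2 * c * s)" .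
  let ?S1 = "W \<times> (PiE {..<t} (\<lambda>_. G))" and ?S2 = "W \<times> G"
  have "card ?S1 = card W * card G ^ t"
    by (simp add: card_cartesian_product card_PiE)
  also have "\<dots> \<le> 2 ^ (2 * c * s) * (2 ^ c) ^ t"
    using cW cG by (intro mult_mono power_mono) auto
  finally have c1: "card ?S1 \<le> 2 ^ (2 * c * s + c * t)"
    by (simp add: power_add power_mult)
  have "card ?S2 \<le> 2 ^ (2 * c * s) * 2 ^ c"
    unfolding card_cartesian_product using cW cG by (intro mult_mono) auto
  then have c2: "card ?S2 \<le> 2 ^ (2 * c * s + c)"
    by (simp add: power_add)
  define hw where "hw p = (\<lambda>b. round_down \<delta> (bucket A h (heavy \<tau> (pmf p)) b))" for p
  \<comment> \<open>Restricting to \<open>{..<t}\<close> places the sketch in the finite set of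
    extensional functions \<open>PiE\<close>.\<close>
  define sk where "sk p = restrict (\<lambda>i. round_down \<delta> (sketch A u (light \<tau> (pmf p)) i)) {..<t}" for p
  \<comment> \<open>Bob replies with his heavy buckets and the rounded \<open>R1\<close>; Alice
    closes with the rounded \<open>R2\<close>, and the output adds the two scalars.\<close>
  define m2 where "m2 = (\<lambda>(y, z) q. (hw q, round_down \<delta>
      ((\<Sum>b<M. y b * bucket A h (pmf q) b) + (\<Sum>i<t. z i * sketch A u (light \<tau> (pmf q)) i))))"
  define m3 where "m3 = (\<lambda>(_ :: (nat \<Rightarrow> real) \<times> (nat \<Rightarrow> real)) (y :: nat \<Rightarrow> real, _ :: real) p.
      round_down \<delta> (\<Sum>b<M. y b * bucket A h (light \<tau> (pmf p)) b))"
  define out where "out = (\<lambda>(_ :: (nat \<Rightarrow> real) \<times> (nat \<Rightarrow> real)) (_ :: nat \<Rightarrow> real, r) r'. r + r' :: real)"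
  obtain T where T: "depth T \<le> (2 * c * s + c * t) + (2 * c * s + c) + c"
    "\<And>p q. (hw p, sk p) \<in> ?S1 \<Longrightarrow> m2 (hw p, sk p) q \<in> ?S2 \<Longrightarrow>
      m3 (hw p, sk p) (m2 (hw p, sk p) q) p \<in> G \<Longrightarrow>
      run T p q = out (hw p, sk p) (m2 (hw p, sk p) q) (m3 (hw p, sk p) (m2 (hw p, sk p) q) p)"
    using three_round_protocol[of ?S1 _ ?S2 _ G c "\<lambda>p. (hw p, sk p)" m2 m3 out, OF _ c1 _ c2 fG cG]
      fW fG by (auto simp: finite_PiE)
  have "\<bar>run T p q - (\<Sum>x\<in>A. pmf p x * pmf q x)\<bar> \<le> 5 * \<delta> + collision A h (pmf p) (pmf q)
      + \<bar>sketch_error t A u (light \<tau> (pmf p)) (light \<tau> (pmf q))\<bar>"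
    if p: "p \<in> dists n" and q: "q \<in> dists n" for p q
  proof -
    define R1 where "R1 = (\<Sum>b<M. hw p b * bucket A h (pmf q) b)
      + (\<Sum>i<t. round_down \<delta> (sketch A u (light \<tau> (pmf p)) i) * sketch A u (light \<tau> (pmf q)) i)"
    define R2 where "R2 = (\<Sum>b<M. hw q b * bucket A h (light \<tau> (pmf p)) b)"
    have sums: "sum (pmf p) A \<le> 1" "sum (pmf q) A \<le> 1"
      using sum_pmf_dists p q by (simp_all add: A_def)
    note est = inner_product_estimate[OF A h u \<delta> pmf_nonneg sums(1) pmf_nonneg sums(2), of \<tau>]
    have R: "\<bar>R1\<bar> \<le> 4" "\<bar>R2\<bar> \<le> 4"
      "\<bar>R1 + R2 - (\<Sum>x\<in>A. pmf p x * pmf q x)\<bar> \<le> 3 * \<delta> + collision A h (pmf p) (pmf q)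
        + \<bar>sketch_error t A u (light \<tau> (pmf p)) (light \<tau> (pmf q))\<bar>"
      unfolding R1_def R2_def hw_def by (rule est(4-6))+
    \<comment> \<open>Nonzero rounded buckets are images of heavy points, hence at most
      \<open>s\<close> in number.\<close>
    have hw_W: "hw r \<in> W" if r: "sum (pmf r) A \<le> 1" and "\<And>b. \<bar>bucket A h (heavy \<tau> (pmf r)) b\<bar> \<le> 1" for r
    proof -
      let ?H = "{x\<in>A. heavy \<tau> (pmf r) x \<noteq> 0}"
      have "range (hw r) \<subseteq> G"
        using that(2) \<delta>(1) by (auto simp: hw_def G_def intro!: round_down_in_grid order.trans[OF that(2)])
      moreover have sub: "{b. hw r b \<noteq> 0} \<subseteq> h ` ?H"
        using bucket_nonzero_subset[of A h "heavy \<tau> (pmf r)"] by (force simp: hw_def)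
      moreover have "card {b. hw r b \<noteq> 0} \<le> card (h ` ?H)"
        using sub A by (intro card_mono) auto
      then have "card {b. hw r b \<noteq> 0} \<le> s"
        using card_image_le[of ?H h] card_heavy_le[OF A \<tau> pmf_nonneg r] A by (simp add: s_def)
      ultimately show ?thesis
        using h by (auto simp: W_def sparse_funs_def)
    qed
    have "sk p \<in> PiE {..<t} (\<lambda>_. G)"
      using \<delta>(1) by (auto simp: sk_def G_def intro!: round_down_in_grid order.trans[OF est(3)])
    then have "(hw p, sk p) \<in> ?S1"
      using hw_W[OF sums(1) est(1)] by simp
    moreover have m2: "m2 (hw p, sk p) q = (hw q, round_down \<delta> R1)"
      by (simp add: m2_def R1_def sk_def)
    moreover have m3: "m3 (hw p, sk p) (hw q, round_down \<delta> R1) p = round_down \<delta> R2"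
      by (simp add: m3_def R2_def)
    ultimately have "run T p q = round_down \<delta> R1 + round_down \<delta> R2"
      using T(2)[of p q] hw_W[OF sums(2) est(2)] round_down_in_grid[OF \<delta>(1) R(1)]
        round_down_in_grid[OF \<delta>(1) R(2)]
      by (simp add: G_def[symmetric] out_def)
    then show ?thesis
      using R(3) round_down_error[OF \<delta>(1), of R1] round_down_error[OF \<delta>(1), of R2] by linarith
  qed
  moreover have "depth T \<le> c * (4 * s + t + 2)"
    using T(1) by (simp add: algebra_simps)
  ultimately show ?thesis
    by blast
qed

section \<open>Success probability and choice of parameters\<close>

text \<open>The error budget is \<open>\<epsilon> / 2\<close> for rounding and
  \<open>\<epsilon> / 4\<close> each for collisions and sketch. The latter two are exceeded with
  probability at most \<open>1 / 6\<close> each: by Markov when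
  \<open>M \<ge> 24 / \<epsilon>\<close>, by the second moment when
  \<open>t \<ge> 192 * \<tau>\<^sup>2 / \<epsilon>\<^sup>2\<close>.\<close>

lemma Rbar_EQ_fun_le:
  fixes \<epsilon> \<tau> :: real
  assumes \<epsilon>: "0 < \<epsilon>" "\<epsilon> \<le> 1" and \<tau>: "0 < \<tau>"
    and M: "24 / \<epsilon> \<le> real M" "M \<le> 2 ^ c" and c: "80 / \<epsilon> + 3 \<le> 2 ^ c"
    and t: "192 * \<tau>\<^sup>2 / \<epsilon>\<^sup>2 \<le> real t"
  shows "Rbar n \<epsilon> EQ_fun \<le> enat (c * (4 * nat \<lfloor>1 / \<tau>\<rfloor> + t + 2))"
proof -
  define A where "A = bitstrings n"
  define K where "K = c * (4 * nat \<lfloor>1 / \<tau>\<rfloor> + t + 2)"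
  \<comment> \<open>Makes \<open>5 * \<delta> = \<epsilon> / 2\<close>, and the grid of radius 4
    then has at most \<open>80 / \<epsilon> + 3\<close> points.\<close>
  define \<delta> where "\<delta> = \<epsilon> / 10"
  define err where "err h u p q = collision A h (pmf p) (pmf q)
      + \<bar>sketch_error t A u (light \<tau> (pmf p)) (light \<tau> (pmf q))\<bar>" for h u p q
  have A: "finite A"
    by (simp add: A_def finite_bitstrings)
  have M0: "0 < M" and t0: "0 < t"
  proof -
    have "0 < 24 / \<epsilon>" "0 < 192 * \<tau>\<^sup>2 / \<epsilon>\<^sup>2"
      using \<epsilon> \<tau> by simp_all
    then have "0 < real M" "0 < real t"
      using M t by linarith+
    then show "0 < M" "0 < t"
      by simp_all
  qed
  have "real (card (grid \<delta> 4)) \<le> 80 / \<epsilon> + 3"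
    using card_grid[of \<delta> 4] \<epsilon> by (simp add: \<delta>_def)
  also have "\<dots> \<le> real (2 ^ c)"
    using c by simp
  finally have G: "card (grid \<delta> 4) \<le> 2 ^ c"
    by linarith
  define good where "good h u T \<longleftrightarrow> depth T \<le> K \<and> (\<forall>p\<in>dists n. \<forall>q\<in>dists n.
      \<bar>run T p q - (\<Sum>x\<in>A. pmf p x * pmf q x)\<bar> \<le> 5 * \<delta> + err h u p q)" for h u T
  \<comment> \<open>One tree is fixed for each hash and sketch before any inputs are given, so a
    single distribution \<open>P\<close> serves all input pairs.\<close>
  define T where "T h u = (SOME T. good h u T)" for h u
  have ex_good: "\<exists>T. good h u T"
    if "h ` A \<subseteq> {..<M}" "u ` A \<subseteq> {..<t} \<times> {-1, 1}" for h u
    using protocol_for_hash_and_sketch[of h n M u t \<delta> \<tau> c] that \<epsilon> \<tau> M0 M G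
    by (simp add: good_def A_def K_def \<delta>_def err_def add.assoc)
  have good_T: "good h u (T h u)"
    if "h ` A \<subseteq> {..<M}" "u ` A \<subseteq> {..<t} \<times> {-1, 1}" for h u
    unfolding T_def by (rule someI_ex[OF ex_good[OF that]])
  have T: "depth (T h u) \<le> K"
    "p \<in> dists n \<Longrightarrow> q \<in> dists n \<Longrightarrow>
      \<bar>run (T h u) p q - (\<Sum>x\<in>A. pmf p x * pmf q x)\<bar> \<le> 5 * \<delta> + err h u p q"
    if "h ` A \<subseteq> {..<M}" "u ` A \<subseteq> {..<t} \<times> {-1, 1}" for h u p q
    using good_T[OF that] unfolding good_def by simp_all
  define Om where "Om = pair_pmf (random_hash A M) (random_sketch A t)"
  define P where "P = map_pmf (\<lambda>(h, u). T h u) Om"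
  have supp: "h ` A \<subseteq> {..<M}" "u ` A \<subseteq> {..<t} \<times> {-1, 1}" if "(h, u) \<in> set_pmf Om" for h u
  proof -
    have "h \<in> set_pmf (random_hash A M)" "u \<in> set_pmf (random_sketch A t)"
      using that by (simp_all add: Om_def)
    then show "h ` A \<subseteq> {..<M}" "u ` A \<subseteq> {..<t} \<times> {-1, 1}"
      using set_random_hash(2)[OF A M0] set_random_sketch(2)[OF A t0] by blast+
  qed
  have "worst_case_cost P \<le> enat K"
    unfolding worst_case_cost_def
  proof (rule SUP_least)
    fix r assume "r \<in> set_pmf P"
    then obtain h u where "(h, u) \<in> set_pmf Om" "r = T h u"
      by (auto simp: P_def)
    then show "enat (depth r) \<le> enat K"
      using T(1)[OF supp] by simp
  qed
  moreover have "estimates n \<epsilon> EQ_fun P"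
    unfolding estimates_def
  proof (intro ballI)
    fix p q assume p: "p \<in> dists n" and q: "q \<in> dists n"
    let ?E = "measure_pmf.expectation (pair_pmf p q) (\<lambda>(x, y). EQ_fun x y)"
    let ?C = "\<lambda>h. collision A h (pmf p) (pmf q)"
    let ?D = "\<lambda>u. sketch_error t A u (light \<tau> (pmf p)) (light \<tau> (pmf q))"
    have sums: "sum (pmf p) A = 1" "sum (pmf q) A = 1"
      using sum_pmf_dists p q by (simp_all add: A_def)
    have "measure_pmf.prob (random_hash A M) {h \<in> space (random_hash A M). ?C h \<ge> \<epsilon> / 4}
        \<le> measure_pmf.expectation (random_hash A M) ?C / (\<epsilon> / 4)"
      using \<epsilon> set_random_hash(1)[OF A M0]
      by (intro integral_Markov_inequality_measure[where A = UNIV] integrable_measure_pmf_finite)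
        (auto intro!: collision_nonneg)
    also have "\<dots> \<le> (1 / real M) / (\<epsilon> / 4)"
      using expectation_collision_le[OF A M0, of "pmf p" "pmf q"] \<epsilon> sums
      by (intro divide_right_mono) auto
    also have "\<dots> \<le> 1 / 6"
      using M \<epsilon> M0 by (simp add: field_simps)
    finally have coll: "measure_pmf.prob (random_hash A M) {h. ?C h \<ge> \<epsilon> / 4} \<le> 1 / 6"
      by simp
    have "measure_pmf.prob (random_sketch A t) {u \<in> space (random_sketch A t). \<bar>?D u\<bar> \<ge> \<epsilon> / 4}
        \<le> measure_pmf.expectation (random_sketch A t) (\<lambda>u. (?D u)\<^sup>2) / (\<epsilon> / 4)\<^sup>2"
      using \<epsilon> set_random_sketch(1)[OF A t0]
      by (intro measure_pmf.second_moment_method integrable_measure_pmf_finite) auto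
    also have "\<dots> \<le> (2 / real t * \<tau> * \<tau>) / (\<epsilon> / 4)\<^sup>2"
    proof (intro divide_right_mono order.trans[OF expectation_sketch_error_le[OF A t0]] mult_mono)
      show "(\<Sum>x\<in>A. (light \<tau> (pmf p) x)\<^sup>2) \<le> \<tau>" "(\<Sum>x\<in>A. (light \<tau> (pmf q) x)\<^sup>2) \<le> \<tau>"
        using sums by (auto intro!: sum_light_square_le A \<tau>)
    qed (use \<tau> in \<open>auto intro!: sum_nonneg\<close>)
    also have "\<dots> \<le> 1 / 6"
      using t \<epsilon> t0 by (simp add: field_simps power2_eq_square)
    finally have sketch: "measure_pmf.prob (random_sketch A t) {u. \<bar>?D u\<bar> \<ge> \<epsilon> / 4} \<le> 1 / 6"
      by simp
    have "measure_pmf.prob P {r. \<not> \<bar>run r p q - ?E\<bar> \<le> \<epsilon>}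
        = measure_pmf.prob Om {z. \<not> \<bar>run (case z of (h, u) \<Rightarrow> T h u) p q - ?E\<bar> \<le> \<epsilon>}"
      by (simp add: P_def vimage_def)
    also have "\<dots> \<le> measure_pmf.prob Om (fst -` {h. ?C h \<ge> \<epsilon> / 4} \<union> snd -` {u. \<bar>?D u\<bar> \<ge> \<epsilon> / 4})"
    proof (rule measure_pmf.finite_measure_mono_AE)
      show "AE z in Om. z \<in> {z. \<not> \<bar>run (case z of (h, u) \<Rightarrow> T h u) p q - ?E\<bar> \<le> \<epsilon>}
          \<longrightarrow> z \<in> fst -` {h. ?C h \<ge> \<epsilon> / 4} \<union> snd -` {u. \<bar>?D u\<bar> \<ge> \<epsilon> / 4}"
      proof (intro AE_pmfI impI)
        fix z assume z: "z \<in> set_pmf Om"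
          and bad: "z \<in> {z. \<not> \<bar>run (case z of (h, u) \<Rightarrow> T h u) p q - ?E\<bar> \<le> \<epsilon>}"
        obtain h u where hu: "z = (h, u)"
          by (cases z)
        have "\<bar>run (T h u) p q - ?E\<bar> \<le> 5 * \<delta> + err h u p q"
          using T(2)[OF supp p q] z hu expectation_EQ_fun[OF p q] by (simp add: A_def)
        \<comment> \<open>If both errors were below \<open>\<epsilon> / 4\<close>, the total would
          be below \<open>\<epsilon>\<close>; so failure lies in the union of the two bad
          events.\<close>
        then have "\<epsilon> / 4 \<le> ?C h \<or> \<epsilon> / 4 \<le> \<bar>?D u\<bar>"
          using bad hu unfolding err_def \<delta>_def by (simp add: not_le) linarith
        then show "z \<in> fst -` {h. ?C h \<ge> \<epsilon> / 4} \<union> snd -` {u. \<bar>?D u\<bar> \<ge> \<epsilon> / 4}"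
          using hu by auto
      qed
    qed auto
    also have "\<dots> \<le> measure_pmf.prob Om (fst -` {h. ?C h \<ge> \<epsilon> / 4})
        + measure_pmf.prob Om (snd -` {u. \<bar>?D u\<bar> \<ge> \<epsilon> / 4})"
      by (intro measure_Un_le) auto
    also have "measure_pmf.prob Om (fst -` {h. ?C h \<ge> \<epsilon> / 4})
        = measure_pmf.prob (map_pmf fst Om) {h. ?C h \<ge> \<epsilon> / 4}"
      by (simp only: measure_map_pmf)
    also have "measure_pmf.prob Om (snd -` {u. \<bar>?D u\<bar> \<ge> \<epsilon> / 4})
        = measure_pmf.prob (map_pmf snd Om) {u. \<bar>?D u\<bar> \<ge> \<epsilon> / 4}"
      by (simp only: measure_map_pmf)
    also have "measure_pmf.prob (map_pmf fst Om) {h. ?C h \<ge> \<epsilon> / 4}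
        + measure_pmf.prob (map_pmf snd Om) {u. \<bar>?D u\<bar> \<ge> \<epsilon> / 4} \<le> 1 / 6 + 1 / 6"
      unfolding Om_def map_fst_pair_pmf map_snd_pair_pmf by (intro add_mono coll sketch)
    finally have "measure_pmf.prob P {r. \<not> \<bar>run r p q - ?E\<bar> \<le> \<epsilon>} \<le> 1 / 3"
      by simp
    moreover have "measure_pmf.prob P {r. \<not> \<bar>run r p q - ?E\<bar> \<le> \<epsilon>}
        = 1 - measure_pmf.prob P {r. \<bar>run r p q - ?E\<bar> \<le> \<epsilon>}"
      using measure_pmf.prob_compl[of "{r. \<bar>run r p q - ?E\<bar> \<le> \<epsilon>}" P]
      by (simp add: Compl_eq_Diff_UNIV[symmetric] Collect_neg_eq)
    ultimately show "2 / 3 \<le> measure_pmf.prob P {r. \<bar>run r p q - ?E\<bar> \<le> \<epsilon>}"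
      by linarith
  qed
  ultimately show ?thesis
    unfolding Rbar_def K_def by (auto intro: INF_lower2)
qed

text \<open>The inner product of two distributions lies between 0 and 1, so the constant answer
  \<open>1 / 2\<close> is accurate enough.\<close>

lemma Rbar_EQ_fun_trivial:
  assumes "1 / 2 \<le> \<epsilon>"
  shows "Rbar n \<epsilon> EQ_fun = 0"
proof -
  let ?P = "return_pmf (Output (1 / 2)) :: rand_est_protocol"
  have "estimates n \<epsilon> EQ_fun ?P"
    unfolding estimates_def
  proof (intro ballI)
    fix p q assume p: "p \<in> dists n" and q: "q \<in> dists n"
    have "(\<Sum>x\<in>bitstrings n. pmf p x * pmf q x) \<le> (\<Sum>x\<in>bitstrings n. pmf p x * 1)"
      by (intro sum_mono mult_left_mono) (auto simp: pmf_le_1)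
    then have "(\<Sum>x\<in>bitstrings n. pmf p x * pmf q x) \<le> 1"
      using sum_pmf_dists[OF p] by simp
    moreover have "0 \<le> (\<Sum>x\<in>bitstrings n. pmf p x * pmf q x)"
      by (intro sum_nonneg) auto
    ultimately show "2 / 3 \<le> measure_pmf.prob ?P
        {t. \<bar>run t p q - measure_pmf.expectation (pair_pmf p q) (\<lambda>(x, y). EQ_fun x y)\<bar> \<le> \<epsilon>}"
      using assms unfolding expectation_EQ_fun[OF p q] by (simp add: indicator_def abs_le_iff)
  qed
  then have "Rbar n \<epsilon> EQ_fun \<le> worst_case_cost ?P"
    unfolding Rbar_def by (intro INF_lower) simp
  then show ?thesis
    by (simp add: worst_case_cost_def zero_enat_def[symmetric])
qed

text \<open>For \<open>\<epsilon>\<close> close to \<open>1\<close> the right-hand side is smaller than \<open>1\<close>, so the case \<open>\<epsilon> \<ge> 1 / 2\<close> needs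
  the protocol without communication.\<close>

theorem theorem3p1:
  shows "\<exists>(C::real) (k::nat). \<forall>(n::nat) (\<epsilon>::real). 0 < \<epsilon> \<and> \<epsilon> < 1 \<longrightarrow>
    ereal_of_enat (Rbar n \<epsilon> EQ_fun) \<le> ereal (C * (ln (1 / \<epsilon>)) ^ k * (1 / \<epsilon> powr (2 / 3)))"
proof (intro exI allI impI)
  fix n :: nat and \<epsilon> :: real
  assume "0 < \<epsilon> \<and> \<epsilon> < 1"
  then have \<epsilon>: "0 < \<epsilon>" "\<epsilon> < 1"
    by auto
  \<comment> \<open>One logarithmic factor suffices; 4000 is a round number above
    \<open>18 * 199\<close>, the product of the constants found below.\<close>
  show "ereal_of_enat (Rbar n \<epsilon> EQ_fun) \<le> ereal (4000 * (ln (1 / \<epsilon>)) ^ 1 * (1 / \<epsilon> powr (2 / 3)))"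
  proof (cases "1 / 2 \<le> \<epsilon>")
    case True
    have "0 \<le> ln (1 / \<epsilon>)"
      using \<epsilon> by simp
    then show ?thesis
      using True by (simp add: Rbar_EQ_fun_trivial)
  next
    case False
    define \<tau> where "\<tau> = \<epsilon> powr (2 / 3)"
    define X where "X = 1 / \<tau>"
    \<comment> \<open>Since \<open>1 / \<epsilon> > 2\<close>, the value
      \<open>100 / \<epsilon>\<close> exceeds both \<open>24 / \<epsilon> + 1\<close>, which bounds
      \<open>M\<close>, and the grid bound \<open>80 / \<epsilon> + 3\<close>.\<close>
    define c where "c = nat \<lceil>log 2 (100 / \<epsilon>)\<rceil>"
    define M where "M = nat \<lceil>24 / \<epsilon>\<rceil>"
    define t where "t = nat \<lceil>192 * X\<rceil>"
    have \<tau>: "0 < \<tau>" "\<tau> \<le> 1"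
      using \<epsilon> by (auto simp: \<tau>_def intro: powr_le1)
    have X1: "1 \<le> X"
      using \<tau> by (simp add: X_def)
    have inv: "2 < 1 / \<epsilon>"
      using False \<epsilon> by (simp add: field_simps)
    have "\<tau> ^ 3 = \<epsilon>\<^sup>2"
      using \<epsilon> by (simp add: \<tau>_def powr_powr flip: powr_numeral)
    \<comment> \<open>The balance behind the exponent \<open>2 / 3\<close>: the sketch length, of
      order \<open>\<tau>\<^sup>2 / \<epsilon>\<^sup>2\<close>, matches the bound
      \<open>1 / \<tau>\<close> on the number of heavy points.\<close>
    then have tauX: "\<tau>\<^sup>2 / \<epsilon>\<^sup>2 = X"
      using \<tau> \<epsilon> by (simp add: X_def field_simps power3_eq_cube power2_eq_square)
    have "2 powr (log 2 (100 / \<epsilon>)) \<le> 2 powr (real c)"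
      unfolding c_def by (intro powr_mono) linarith+
    then have c100: "100 / \<epsilon> \<le> 2 ^ c"
      using \<epsilon> by (simp add: powr_realpow)
    have "real M \<le> 24 * (1 / \<epsilon>) + 1"
      using inv unfolding M_def by linarith
    also have "\<dots> \<le> 100 * (1 / \<epsilon>)"
      using inv by linarith
    also have "\<dots> \<le> 2 ^ c"
      using c100 by simp
    finally have Mc: "M \<le> 2 ^ c"
      by (metis of_nat_le_iff of_nat_numeral of_nat_power)
    have "Rbar n \<epsilon> EQ_fun \<le> enat (c * (4 * nat \<lfloor>1 / \<tau>\<rfloor> + t + 2))"
    proof (rule Rbar_EQ_fun_le[OF _ _ _ _ Mc])
      show "24 / \<epsilon> \<le> real M"
        unfolding M_def by linarith
      have "80 * (1 / \<epsilon>) + 3 \<le> 100 * (1 / \<epsilon>)"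
        using inv by linarith
      then show "80 / \<epsilon> + 3 \<le> 2 ^ c"
        using c100 by simp
      show "192 * \<tau>\<^sup>2 / \<epsilon>\<^sup>2 \<le> real t"
        unfolding times_divide_eq_right[symmetric] tauX t_def by linarith
    qed (use \<epsilon> \<tau> in auto)
    then have "ereal_of_enat (Rbar n \<epsilon> EQ_fun) \<le> ereal_of_enat (enat (c * (4 * nat \<lfloor>1 / \<tau>\<rfloor> + t + 2)))"
      by (simp only: ereal_of_enat_le_iff)
    also have "\<dots> = ereal (real c * (4 * real (nat \<lfloor>1 / \<tau>\<rfloor>) + real t + 2))"
      by (simp add: algebra_simps)
    also have "\<dots> \<le> ereal ((18 * ln (1 / \<epsilon>)) * (199 * X))"
      unfolding ereal_less_eq
    proof (intro mult_mono)
      have "real (nat \<lfloor>1 / \<tau>\<rfloor>) \<le> X" "real t \<le> 192 * X + 1"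
        using X1 unfolding t_def X_def[symmetric] by linarith+
      \<comment> \<open>The additive constants 1 and 2 are absorbed by \<open>X \<ge> 1\<close>: 199
        is 4 + 192 + 1 + 2.\<close>
      then show "4 * real (nat \<lfloor>1 / \<tau>\<rfloor>) + real t + 2 \<le> 199 * X"
        using X1 by linarith
      define l where "l = log 2 (1 / \<epsilon>)"
      have "log 2 2 \<le> l"
        unfolding l_def using inv \<epsilon> by (subst log_le_cancel_iff) auto
      then have l1: "1 \<le> l"
        by simp
      have "log 2 (100 / \<epsilon>) = log 2 100 + l"
        using \<epsilon> log_mult[of 2 100 "1 / \<epsilon>"] by (simp add: l_def)
      moreover have "log 2 100 \<le> log 2 (2 ^ 7 :: real)"
        by (subst log_le_cancel_iff) auto
      then have "log 2 (100 :: real) \<le> 7"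
        by (simp only: log_pow_cancel)
      \<comment> \<open>\<open>c\<close> is at most \<open>7 + l + 1\<close>, and
        \<open>l \<ge> 1\<close> absorbs the 8; this is where \<open>\<epsilon> < 1 / 2\<close>
        matters.\<close>
      ultimately have "real c \<le> 9 * l"
        using l1 unfolding c_def by linarith
      also have "l = ln (1 / \<epsilon>) / ln 2"
        by (simp add: l_def log_def)
      also have "9 * (ln (1 / \<epsilon>) / ln 2) \<le> 9 * (ln (1 / \<epsilon>) * 2)"
      proof -
        have "(1 :: real) / 2 \<le> ln 2"
          \<comment> \<open>At \<open>1 / 2\<close> the inequality reads
            \<open>- ln 2 \<le> - 1 / 2\<close>.\<close>
          using ln_le_minus_one[of "1 / 2"] by (simp add: ln_div)
        moreover have "0 \<le> ln (1 / \<epsilon>)"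
          using \<epsilon> by simp
        ultimately have "ln (1 / \<epsilon>) * (1 / 2) \<le> ln (1 / \<epsilon>) * ln 2"
          by (intro mult_left_mono)
        then show ?thesis
          by (simp add: field_simps)
      qed
      finally show "real c \<le> 18 * ln (1 / \<epsilon>)"
        by simp
    qed (use \<epsilon> in auto)
    also have "\<dots> \<le> ereal (4000 * (ln (1 / \<epsilon>)) ^ 1 * (1 / \<epsilon> powr (2 / 3)))"
    proof -
      have "0 \<le> ln (1 / \<epsilon>) * X"
        using \<epsilon> X1 by simp
      then show ?thesis
        by (simp add: X_def \<tau>_def)
    qed
    finally show ?thesis .
  qed
qed

end
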